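(* Suppose that $u=u(t,x)\in\omega$ and $U_1,U_2,\ldots$ (with values in $\mathbb{R}^N$) are smooth functions of $(t,x)$ such that the formal expansion $$U^\varepsilon=\mathcal{E}(u)+\varepsilon U_1+\varepsilon^2U_2+\cdots,\qquad u=QU^\varepsilon,$$ (so that $QU_1=QU_2=\cdots=0$) satisfies $$\varepsilon\,\partial_tU^\varepsilon+\partial_xF(U^\varepsilon)=-\frac{R(U^\varepsilon)}{\varepsilon}$$ in the sense of formal power series in $\varepsilon$. Then $u$ satisfies the effective system $$\partial_tu=-\partial_x\big(Q\,A(\mathcal{E}(u))\,U_1\big)=\partial_x\big(\mathcal{M}(u)\,\partial_xu\big)$$ for some $n\times n$ matrix $\mathcal{M}(u)$ depending only on $u$ (determined by $F,R,Q,\mathcal{E}$), where $U_1$ is the unique solution to the first-order corrector problem $$B(\mathcal{E}(u))\,U_1=-A(\mathcal{E}(u))\,\partial_x\big(\mathcal{E}(u)\big),\qquad QU_1=0.$$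
   Context: Let $\Omega\subset\mathbb{R}^N$ be convex and open, and let $F,R:\Omega\to\mathbb{R}^N$ be smooth. Write $A(U):=D_UF(U)$ and $B(U):=D_UR(U)$ ($N\times N$ matrices). $A(U)$ is assumed to have real eigenvalues and a basis of eigenvectors for every $U\in\Omega$. Here $t>0$, $x\in\mathbb{R}$. Standing assumptions: (1) $Q$ is an $n\times N$ matrix of rank $n<N$ with $QR(U)=0$ for all $U\in\Omega$; set $\omega:=Q\Omega\subset\mathbb{R}^n$. (2) $\mathcal{E}:\omega\to\Omega$ is a smooth map with $R(\mathcal{E}(u))=0$ and $Q\mathcal{E}(u)=u$ for all $u\in\omega$. (3) $QF(\mathcal{E}(u))=0$ for all $u\in\omega$. (4) For all $u\in\omega$: $\dim\ker B(\mathcal{E}(u))=n$ and $\ker B(\mathcal{E}(u))\cap\operatorname{Im}B(\mathcal{E}(u))=\{0\}$. "In the sense of formal power series" means that $F(U^\varepsilon)$ and $R(U^\varepsilon)$ are Taylor-expanded about $\mathcal{E}(u)$ and the coefficients of each power of $\varepsilon$ on the two sides of the equation are equal. *)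

theory Defs
  imports "HOL-Analysis.Analysis"
begin

text \<open>\<open>iter_deriv f [v\<^sub>1, \<dots>, v\<^sub>m] x\<close> is the \<open>m\<close>-th derivative
  \<open>D\<^sup>m f(x)[v\<^sub>1, \<dots>, v\<^sub>m]\<close>.\<close>

primrec iter_deriv ::
  "('a::euclidean_space \<Rightarrow> 'b::euclidean_space) \<Rightarrow> 'a list \<Rightarrow> 'a \<Rightarrow> 'b" where
  "iter_deriv f [] = f"
| "iter_deriv f (v # vs) = (\<lambda>x. frechet_derivative (iter_deriv f vs) (at x) v)"

text \<open>Infinite differentiability on an \<^emph>\<open>open\<close> set \<open>S\<close>. The derivatives are two-sided, so the values
  of \<open>f\<close> outside \<open>S\<close> do not matter.\<close>

definition smooth_on ::
  "'a::euclidean_space set \<Rightarrow> ('a \<Rightarrow> 'b::euclidean_space) \<Rightarrow> bool" where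
  "smooth_on S f \<longleftrightarrow> (\<forall>vs. \<forall>x\<in>S. iter_deriv f vs differentiable at x)"

text \<open>Real eigenvalues and a basis of eigenvectors.\<close>

definition real_diagonalizable :: "real^'n^'n \<Rightarrow> bool" where
  "real_diagonalizable M \<longleftrightarrow>
     (\<exists>S. independent S \<and> span S = UNIV \<and> (\<forall>v\<in>S. \<exists>l. M *v v = l *\<^sub>R v))"

text \<open>A sequence \<open>V\<close> stands for the formal power series \<open>V 0 + \<epsilon> V 1 + \<epsilon>\<^sup>2 V 2 + \<dots>\<close>.
  \<open>taylor_coeff G V k\<close> is the coefficient of \<open>\<epsilon>\<close> to the power \<open>k\<close> in the Taylor expansion
  \<open>\<Sum>m. 1/m! D\<^sup>m G(V 0)[W, \<dots>, W]\<close> of \<open>G\<close> about \<open>V 0\<close>, where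
  \<open>W = \<epsilon> V 1 + \<epsilon>\<^sup>2 V 2 + \<dots>\<close>: by multilinearity one sums over all \<open>m\<close> and all
  \<open>j\<^sub>1, \<dots>, j\<^sub>m \<ge> 1\<close> with \<open>j\<^sub>1 + \<dots> + j\<^sub>m = k\<close>. The lemma below shows that
  the sum is a finite one.\<close>

definition taylor_coeff ::
  "('a::euclidean_space \<Rightarrow> 'b::euclidean_space) \<Rightarrow> (nat \<Rightarrow> 'a) \<Rightarrow> nat \<Rightarrow> 'b" where
  "taylor_coeff G V k =
     (\<Sum>js | sum_list js = k \<and> (\<forall>j\<in>set js. 1 \<le> j).
        (1 / fact (length js)) *\<^sub>R iter_deriv G (map V js) (V 0))"

lemma finite_compositions: "finite {js. sum_list js = (k::nat) \<and> (\<forall>j\<in>set js. 1 \<le> j)}"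
proof (rule finite_subset)
  have "length js \<le> sum_list js" if "\<forall>j\<in>set js. 1 \<le> j" for js :: "nat list"
    using that by (induction js) auto
  then show "{js. sum_list js = k \<and> (\<forall>j\<in>set js. 1 \<le> j)}
      \<subseteq> {js. set js \<subseteq> {..k} \<and> length js \<le> k}"
    using member_le_sum_list by fastforce
  show "finite {js. set js \<subseteq> {..k} \<and> length js \<le> k}"
    by (rule finite_lists_length_le) simp
qed

text \<open>Coefficients indexed by all integers, so that multiplication and division by \<open>\<epsilon>\<close> become
  index shifts.\<close>

definition coeff_int :: "(nat \<Rightarrow> 'a::zero) \<Rightarrow> int \<Rightarrow> 'a" where
  "coeff_int a k = (if k < 0 then 0 else a (nat k))"

definition pd_t :: "(real \<Rightarrow> real \<Rightarrow> 'a::real_normed_vector) \<Rightarrow> real \<Rightarrow> real \<Rightarrow> 'a" where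
  "pd_t g t x = vector_derivative (\<lambda>s. g s x) (at t)"

definition pd_x :: "(real \<Rightarrow> real \<Rightarrow> 'a::real_normed_vector) \<Rightarrow> real \<Rightarrow> real \<Rightarrow> 'a" where
  "pd_x g t x = vector_derivative (\<lambda>y. g t y) (at x)"

text \<open>\<open>U k t x\<close> is the coefficient of \<open>\<epsilon>\<close> to the power \<open>k\<close> in the expansion, with
  \<open>U 0 = E(u)\<close>. The last clause equates, for every integer \<open>k\<close>, the coefficients of that power in
  \<open>\<epsilon> \<partial>\<^sub>t U + \<partial>\<^sub>x F(U)\<close> and \<open>- R(U) / \<epsilon>\<close>; it starts effectively at \<open>k = -1\<close>.\<close>

definition formal_expansion_solution ::
  "(real^'N) set \<Rightarrow> (real^'N \<Rightarrow> real^'N) \<Rightarrow> (real^'N \<Rightarrow> real^'N) \<Rightarrow> real^'N^'n \<Rightarrow>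
   (real^'n \<Rightarrow> real^'N) \<Rightarrow> (real \<Rightarrow> real \<Rightarrow> real^'n) \<Rightarrow> (nat \<Rightarrow> real \<Rightarrow> real \<Rightarrow> real^'N) \<Rightarrow> bool"
  where
  "formal_expansion_solution \<Omega> F R Q E u U \<longleftrightarrow>
     smooth_on ({0<..} \<times> UNIV) (\<lambda>(t, x). u t x) \<and>
     (\<forall>k\<ge>1. smooth_on ({0<..} \<times> UNIV) (\<lambda>(t, x). U k t x)) \<and>
     (\<forall>t>0. \<forall>x.
        u t x \<in> (*v) Q ` \<Omega> \<and>
        U 0 t x = E (u t x) \<and>
        (\<forall>k. Q *v U k t x = (if k = 0 then u t x else 0)) \<and>
        (\<forall>k::int.
           pd_t (\<lambda>t x. coeff_int (\<lambda>j. U j t x) (k - 1)) t x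
           + pd_x (\<lambda>t x. coeff_int (taylor_coeff F (\<lambda>j. U j t x)) k) t x
           = - coeff_int (taylor_coeff R (\<lambda>j. U j t x)) (k + 1)))"

end

theory Submission
  imports Defs
begin

text \<open>The coefficient of \<open>\<epsilon>\<close> to the power \<open>0\<close> says that \<open>U\<^sub>1\<close> solves the corrector problem.
  In the coefficient of \<open>\<epsilon>\<close>, multiplication by \<open>Q\<close> removes the source, because \<open>Q R = 0\<close> on
  the open set \<open>\<Omega>\<close> forces \<open>Q\<close> to kill all derivatives of \<open>R\<close>; what is left is
  \<open>\<partial>\<^sub>t u + \<partial>\<^sub>x (Q A U\<^sub>1) = 0\<close>.

  Differentiating \<open>R \<circ> E = 0\<close> and \<open>Q \<circ> E = id\<close> gives \<open>B E' = 0\<close> and \<open>Q E' = 1\<close>, so by the dimension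
  hypothesis \<open>ker B\<close> is the image of \<open>E'\<close> and meets \<open>ker Q\<close> trivially. Hence \<open>T = B + E' Q\<close> is
  invertible: \<open>T v = 0\<close> implies \<open>Q v = Q T v = 0\<close> and then \<open>B v = 0\<close>. The corrector satisfies
  \<open>T U\<^sub>1 = - A E' \<partial>\<^sub>x u\<close>, so \<open>M = Q A T\<inverse> A E'\<close>.\<close>

section \<open>Smoothness and iterated derivatives\<close>

lemma smooth_on_imp_differentiable:
  assumes "smooth_on S f" "x \<in> S"
  shows "f differentiable at x"
  using assms unfolding smooth_on_def by (metis iter_deriv.simps(1))

text \<open>A constant matrix commutes with differentiation, and since \<open>S\<close> is open,
  vanishing of the product on \<open>S\<close> gives a zero derivative at each point of
  \<open>S\<close>. Induction on the list of directions therefore keeps the point arbitrary.\<close>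

lemma iter_deriv_matrix_vector_eq_0:
  fixes R :: "'a::euclidean_space \<Rightarrow> real^'m" and Q :: "real^'m^'n"
  assumes "open S" "smooth_on S R" "\<And>x. x \<in> S \<Longrightarrow> Q *v R x = 0" "x \<in> S"
  shows "Q *v iter_deriv R vs x = 0"
  using \<open>x \<in> S\<close>
proof (induction vs arbitrary: x)
  case Nil
  then show ?case using assms by simp
next
  case (Cons v vs)
  let ?g = "iter_deriv R vs"
  have "(?g has_derivative frechet_derivative ?g (at x)) (at x)"
    using assms(2) Cons.prems by (simp add: smooth_on_def frechet_derivative_works[symmetric])
  then have "((\<lambda>y. Q *v ?g y) has_derivative (\<lambda>h. Q *v frechet_derivative ?g (at x) h)) (at x)"
    by (rule bounded_linear.has_derivative[OF matrix_vector_mul_bounded_linear])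
  moreover have "((\<lambda>y. Q *v ?g y) has_derivative (\<lambda>h. 0)) (at x)"
    by (rule has_derivative_transform_within_open[OF has_derivative_const assms(1) Cons.prems])
      (simp add: Cons.IH)
  ultimately have "(\<lambda>h. Q *v frechet_derivative ?g (at x) h) = (\<lambda>h. 0)"
    by (rule has_derivative_unique)
  then show ?case by (simp add: fun_eq_iff)
qed

lemma taylor_coeff_matrix_vector_eq_0:
  fixes R :: "'a::euclidean_space \<Rightarrow> real^'m" and Q :: "real^'m^'n"
  assumes "open S" "smooth_on S R" "\<And>x. x \<in> S \<Longrightarrow> Q *v R x = 0" "V 0 \<in> S"
  shows "Q *v taylor_coeff R V k = 0"
  unfolding taylor_coeff_def
  by (simp add: linear_sum[OF matrix_vector_mul_linear] linear_cmul[OF matrix_vector_mul_linear]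
      iter_deriv_matrix_vector_eq_0[OF assms])

section \<open>Low-order Taylor coefficients\<close>

lemma taylor_coeff_0: "taylor_coeff G V 0 = G (V 0)"
proof -
  have "js = []" if "sum_list js = (0::nat)" "\<forall>j\<in>set js. 1 \<le> j" for js
    using that by (cases js) auto
  then have "{js. sum_list js = (0::nat) \<and> (\<forall>j\<in>set js. 1 \<le> j)} = {[]}" by auto
  then show ?thesis by (simp add: taylor_coeff_def)
qed

lemma taylor_coeff_1: "taylor_coeff G V 1 = frechet_derivative G (at (V 0)) (V 1)"
proof -
  have "js = [1]" if "sum_list js = (1::nat)" "\<forall>j\<in>set js. 1 \<le> j" for js
  proof (cases js)
    case (Cons j ks)
    then show ?thesis using that by (cases ks) auto
  qed (use that in simp)
  then have "{js. sum_list js = (1::nat) \<and> (\<forall>j\<in>set js. 1 \<le> j)} = {[1]}" by auto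
  then show ?thesis by (simp add: taylor_coeff_def)
qed

section \<open>Jacobians: chain rule, differentiability, kernels\<close>

lemma frechet_derivative_eq_jacobian:
  fixes f :: "real^'m \<Rightarrow> real^'n"
  assumes "f differentiable at x"
  shows "frechet_derivative f (at x) v = jacobian f (at x) *v v"
  unfolding jacobian_def
  by (simp add: matrix_works linear_frechet_derivative[OF assms])

lemma has_vector_derivative_compose_jacobian:
  fixes f :: "real^'m \<Rightarrow> real^'n"
  assumes "f differentiable at (g s)" "(g has_vector_derivative g') (at s)"
  shows "((\<lambda>s. f (g s)) has_vector_derivative jacobian f (at (g s)) *v g') (at s)"
  using has_derivative_compose[OF assms(2)[unfolded has_vector_derivative_def]
      assms(1)[unfolded jacobian_works]]
  by (simp add: has_vector_derivative_def linear_cmul[OF matrix_vector_mul_linear])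

text \<open>Smoothness speaks of derivatives along fixed directions, so \<open>v\<close> is expanded
  in the standard basis: the product becomes a finite sum of scalar coordinates times first
  derivatives of \<open>f\<close> along the axes. This gives differentiability of the flux
  \<open>A(E(u)) U 1\<close> in space.\<close>

lemma jacobian_mult_differentiable:
  fixes f :: "real^'m \<Rightarrow> real^'n" and z v :: "real \<Rightarrow> real^'m"
  assumes "smooth_on S f" "z y \<in> S" "z differentiable at y" "v differentiable at y"
  shows "(\<lambda>y. jacobian f (at (z y)) *v v y) differentiable at y"
proof -
  have eq: "jacobian f (at w) *v h = (\<Sum>j\<in>UNIV. (h $ j) *\<^sub>R iter_deriv f [axis j 1] w)" for w h
    by (simp add: vec_eq_iff jacobian_def matrix_def matrix_vector_mult_def mult.commute)
  have "(\<lambda>y. iter_deriv f [axis j 1] (z y)) differentiable at y" for j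
  proof -
    have "iter_deriv f [axis j 1] differentiable at (z y)"
      using assms unfolding smooth_on_def by blast
    then show ?thesis
      using differentiable_chain_at[OF assms(3)] by (simp add: o_def)
  qed
  moreover have "(\<lambda>y. v y $ j) differentiable at y" for j
    using differentiable_chain_at[OF assms(4)
        bounded_linear_imp_differentiable[OF bounded_linear_vec_nth[of j]]]
    by (simp add: o_def)
  ultimately show ?thesis
    unfolding eq by (intro differentiable_sum differentiable_scaleR) auto
qed

lemma smooth_on_imp_differentiable_slices:
  fixes g :: "real \<Rightarrow> real \<Rightarrow> 'b::euclidean_space"
  assumes "smooth_on S (\<lambda>(t, x). g t x)" "(t, x) \<in> S"
  shows "(\<lambda>s. g s x) differentiable at t" and "(\<lambda>y. g t y) differentiable at x"
proof -
  have d: "(\<lambda>(t, x). g t x) differentiable at (t, x)"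
    using smooth_on_imp_differentiable[OF assms] .
  have "(\<lambda>s. (s, x)) differentiable at t" "(\<lambda>y. (t, y)) differentiable at x"
    by (auto intro!: differentiableI derivative_eq_intros)
  from differentiable_chain_at[OF this(1) d] differentiable_chain_at[OF this(2) d]
  show "(\<lambda>s. g s x) differentiable at t" "(\<lambda>y. g t y) differentiable at x"
    by (simp_all add: o_def)
qed

text \<open>Chain rule plus uniqueness of the derivative: an identity for the composition known only
  on an open set can be differentiated there.\<close>

lemma jacobian_comp_eq:
  fixes f :: "real^'m \<Rightarrow> real^'k" and g :: "real^'n \<Rightarrow> real^'m"
  assumes "open S" "a \<in> S" "f differentiable at (g a)" "g differentiable at a"
    and "\<And>x. x \<in> S \<Longrightarrow> f (g x) = h x" "(h has_derivative h') (at a)"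
  shows "jacobian f (at (g a)) *v (jacobian g (at a) *v w) = h' w"
proof -
  have "((\<lambda>x. f (g x)) has_derivative (\<lambda>w. jacobian f (at (g a)) *v (jacobian g (at a) *v w))) (at a)"
    using has_derivative_compose[OF assms(4)[unfolded jacobian_works] assms(3)[unfolded jacobian_works]] .
  moreover have "((\<lambda>x. f (g x)) has_derivative h') (at a)"
    by (rule has_derivative_transform_within_open[OF assms(6,1,2)]) (simp add: assms(5))
  ultimately show ?thesis
    by (rule has_derivative_unique[THEN fun_cong])
qed

text \<open>\<open>D\<close> has the left inverse \<open>Q\<close>, so its range has dimension
  \<open>CARD('n)\<close>; lying inside the kernel of \<open>B\<close>, it equals that kernel. A
  kernel vector is thus \<open>D *v w\<close>, and applying \<open>Q\<close> recovers
  \<open>w\<close>.\<close>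

lemma kernels_meet_trivially:
  fixes B :: "real^'m^'m" and D :: "real^'n^'m" and Q :: "real^'m^'n"
  assumes BD: "\<And>w. B *v (D *v w) = 0" and QD: "\<And>w. Q *v (D *v w) = w"
    and dim: "dim {v. B *v v = 0} = CARD('n)"
    and v: "B *v v = 0" "Q *v v = 0"
  shows "v = 0"
proof -
  have "inj ((*v) D)" by (metis QD injI)
  then have "dim (range ((*v) D)) = CARD('n)"
    using dim_image_eq[OF matrix_vector_mul_linear, of D UNIV] by simp
  moreover have "subspace {v. B *v v = 0}"
    using linear_subspace_kernel[OF matrix_vector_mul_linear] .
  moreover have "subspace (range ((*v) D))"
    using linear_subspace_image[OF matrix_vector_mul_linear subspace_UNIV] .
  ultimately have "range ((*v) D) = {v. B *v v = 0}"
    using BD dim by (intro subspace_dim_equal) auto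
  then obtain w where "v = D *v w" using v by blast
  then show ?thesis using QD[of w] v by simp
qed

theorem theorem2p3:
  fixes \<Omega> :: "(real^'N) set"
    and F R :: "real^'N \<Rightarrow> real^'N"
    and Q :: "real^'N^'n"
    and E :: "real^'n \<Rightarrow> real^'N"
    and A B :: "real^'N \<Rightarrow> real^'N^'N"
    and \<omega> :: "(real^'n) set"
  defines "A \<equiv> (\<lambda>U. jacobian F (at U))"
    and "B \<equiv> (\<lambda>U. jacobian R (at U))"
    and "\<omega> \<equiv> (*v) Q ` \<Omega>"
  assumes "convex \<Omega>" and "open \<Omega>"
    and "smooth_on \<Omega> F" and "smooth_on \<Omega> R"
    and "\<And>U. U \<in> \<Omega> \<Longrightarrow> real_diagonalizable (A U)"
    and "rank Q = CARD('n)" and "CARD('n) < CARD('N)"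
    and "\<And>U. U \<in> \<Omega> \<Longrightarrow> Q *v R U = 0"
    and "smooth_on \<omega> E" and "E ` \<omega> \<subseteq> \<Omega>"
    and "\<And>u. u \<in> \<omega> \<Longrightarrow> R (E u) = 0"
    and "\<And>u. u \<in> \<omega> \<Longrightarrow> Q *v E u = u"
    and "\<And>u. u \<in> \<omega> \<Longrightarrow> Q *v F (E u) = 0"
    and "\<And>u. u \<in> \<omega> \<Longrightarrow> dim {v. B (E u) *v v = 0} = CARD('n)"
    and "\<And>u. u \<in> \<omega> \<Longrightarrow> {v. B (E u) *v v = 0} \<inter> range ((*v) (B (E u))) = {0}"
  shows "\<exists>M :: real^'n \<Rightarrow> real^'n^'n.
    \<forall>(u :: real \<Rightarrow> real \<Rightarrow> real^'n) (U :: nat \<Rightarrow> real \<Rightarrow> real \<Rightarrow> real^'N).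
      formal_expansion_solution \<Omega> F R Q E u U \<longrightarrow>
      (\<forall>t>0. \<forall>x.
         ((\<lambda>y. Q *v (A (E (u t y)) *v U 1 t y)) has_vector_derivative - pd_t u t x) (at x) \<and>
         ((\<lambda>y. M (u t y) *v pd_x u t y) has_vector_derivative pd_t u t x) (at x) \<and>
         (\<forall>V. B (E (u t x)) *v V = - (A (E (u t x)) *v pd_x (\<lambda>t x. E (u t x)) t x) \<and> Q *v V = 0
              \<longleftrightarrow> V = U 1 t x))"
proof -
  define D where "D u = jacobian E (at u)" for u
  define T where "T u = B (E u) + D u ** Q" for u
  define M where "M u = Q ** A (E u) ** matrix_inv (T u) ** A (E u) ** D u" for u
  \<comment> \<open>Full rank makes \<open>Q\<close> surjective, hence an open map. Openness of
    \<open>\<omega>\<close> is what allows the identities for \<open>R (E u)\<close> and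
    \<open>Q *v E u\<close> to be differentiated in \<open>u\<close>.\<close>
  have \<omega>_open: "open \<omega>"
    unfolding \<omega>_def
    by (rule open_surjective_linear_image[OF \<open>open \<Omega>\<close> matrix_vector_mul_linear])
      (use \<open>rank Q = CARD('n)\<close> full_rank_surjective in blast)
  have E_in: "E w \<in> \<Omega>" if "w \<in> \<omega>" for w
    using that \<open>E ` \<omega> \<subseteq> \<Omega>\<close> by blast
  have E_diff: "E differentiable at w" if "w \<in> \<omega>" for w
    using smooth_on_imp_differentiable[OF \<open>smooth_on \<omega> E\<close> that] .
  have F_diff: "F differentiable at z" and R_diff: "R differentiable at z" if "z \<in> \<Omega>" for z
    using smooth_on_imp_differentiable that \<open>smooth_on \<Omega> F\<close> \<open>smooth_on \<Omega> R\<close> by blast+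
  have BD: "B (E w) *v (D w *v h) = 0" if "w \<in> \<omega>" for w h
    unfolding B_def D_def
    by (rule jacobian_comp_eq[OF \<omega>_open that R_diff E_diff])
      (use that E_in \<open>\<And>u. u \<in> \<omega> \<Longrightarrow> R (E u) = 0\<close> in auto)
  have QD: "Q *v (D w *v h) = h" if "w \<in> \<omega>" for w h
  proof -
    have "((\<lambda>x. Q *v E x) has_derivative (\<lambda>h. Q *v (D w *v h))) (at w)"
      using bounded_linear.has_derivative[OF matrix_vector_mul_bounded_linear
          E_diff[OF that, unfolded jacobian_works]] unfolding D_def .
    moreover have "((\<lambda>x. Q *v E x) has_derivative (\<lambda>h. h)) (at w)"
      by (rule has_derivative_transform_within_open[OF has_derivative_ident \<omega>_open that])
        (simp add: \<open>\<And>u. u \<in> \<omega> \<Longrightarrow> Q *v E u = u\<close>)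
    ultimately show ?thesis by (rule has_derivative_unique[THEN fun_cong])
  qed
  \<comment> \<open>This is the first-order case, with the single direction \<open>v\<close>, of the
    vanishing of \<open>Q\<close> on derivatives of \<open>R\<close>.\<close>
  have QB: "Q *v (B z *v v) = 0" if "z \<in> \<Omega>" for z v
    using iter_deriv_matrix_vector_eq_0[OF \<open>open \<Omega>\<close> \<open>smooth_on \<Omega> R\<close>
        \<open>\<And>U. U \<in> \<Omega> \<Longrightarrow> Q *v R U = 0\<close> that, of "[v]"]
      frechet_derivative_eq_jacobian[OF R_diff[OF that]]
    by (simp add: B_def)
  \<comment> \<open>Serves twice: for the injectivity of \<open>T\<close> and for the uniqueness of
    the corrector.\<close>
  have ker0: "v = 0" if "w \<in> \<omega>" "B (E w) *v v = 0" "Q *v v = 0" for w v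
    by (rule kernels_meet_trivially[of "B (E w)" "D w" Q])
      (use that BD QD \<open>\<And>u. u \<in> \<omega> \<Longrightarrow> dim {v. B (E u) *v v = 0} = CARD('n)\<close> in auto)
  have T: "T w *v v = B (E w) *v v + D w *v (Q *v v)" for w v
    by (simp add: T_def matrix_vector_mult_add_rdistrib matrix_vector_mul_assoc)
  have T_inv: "matrix_inv (T w) *v (T w *v v) = v" if "w \<in> \<omega>" for w v
  proof -
    have "x = 0" if "T w *v x = 0" for x
    proof -
      have "Q *v (T w *v x) = Q *v x"
        using QB[OF E_in] QD \<open>w \<in> \<omega>\<close> by (simp add: T matrix_vector_right_distrib)
      then have "Q *v x = 0" using that by simp
      then show ?thesis using ker0[OF \<open>w \<in> \<omega>\<close>] that by (simp add: T)
    qed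
    then have "invertible (T w)"
      using matrix_left_invertible_ker invertible_left_inverse by blast
    then have "matrix_inv (T w) ** T w = mat 1"
      unfolding invertible_def matrix_inv_def by (rule someI_ex[THEN conjunct2])
    then show ?thesis by (simp add: matrix_vector_mul_assoc)
  qed
  have M_corrector: "M w *v h = - (Q *v (A (E w) *v V))"
    if "w \<in> \<omega>" "B (E w) *v V = - (A (E w) *v (D w *v h))" "Q *v V = 0" for w h V
  proof -
    \<comment> \<open>On the kernel of \<open>Q\<close> the matrices \<open>T w\<close> and
      \<open>B (E w)\<close> agree, so the inverse of \<open>T w\<close> solves the corrector
      problem.\<close>
    have "A (E w) *v (D w *v h) = - (T w *v V)" using that by (simp add: T)
    moreover have "matrix_inv (T w) *v (- (T w *v V)) = - V"
      using T_inv[OF that(1)] by (simp add: linear_neg[OF matrix_vector_mul_linear])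
    ultimately show ?thesis
      unfolding M_def
      by (simp add: matrix_vector_mul_assoc[symmetric] linear_neg[OF matrix_vector_mul_linear])
  qed

  \<comment> \<open>Comparison of the orders of the expansion\<close>
  show ?thesis
  proof (intro exI[of _ M] allI impI)
    fix u :: "real \<Rightarrow> real \<Rightarrow> real^'n" and U :: "nat \<Rightarrow> real \<Rightarrow> real \<Rightarrow> real^'N" and t x :: real
    assume sol: "formal_expansion_solution \<Omega> F R Q E u U" and "0 < t"
    have u_in: "u s y \<in> \<omega>" and U0: "U 0 s y = E (u s y)" and QU: "Q *v U 1 s y = 0"
      and coeffs: "pd_t (\<lambda>t x. coeff_int (\<lambda>j. U j t x) (k - 1)) s y
           + pd_x (\<lambda>t x. coeff_int (taylor_coeff F (\<lambda>j. U j t x)) k) s y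
           = - coeff_int (taylor_coeff R (\<lambda>j. U j s y)) (k + 1)" if "0 < s" for s y k
      using sol that unfolding formal_expansion_solution_def \<omega>_def by auto
    have smooth: "smooth_on ({0<..} \<times> UNIV) (\<lambda>(t, x). u t x)"
      "smooth_on ({0<..} \<times> UNIV) (\<lambda>(t, x). U 1 t x)"
      using sol unfolding formal_expansion_solution_def by blast+
    have u_diff: "(\<lambda>s. u s y) differentiable at t" "(\<lambda>y. u t y) differentiable at y"
      and U1_diff: "(\<lambda>y. U 1 t y) differentiable at y" for y
      using smooth_on_imp_differentiable_slices[OF smooth(1), of t y]
        smooth_on_imp_differentiable_slices[OF smooth(2), of t y] \<open>0 < t\<close>
      by simp_all
    have u_t: "((\<lambda>s. u s y) has_vector_derivative pd_t u t y) (at t)"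
      and u_x: "(u t has_vector_derivative pd_x u t y) (at y)" for y
      using u_diff by (simp_all add: pd_t_def pd_x_def vector_derivative_works)
    have Eu_t: "((\<lambda>s. E (u s y)) has_vector_derivative D (u t y) *v pd_t u t y) (at t)"
      and Eu_x: "((\<lambda>y. E (u t y)) has_vector_derivative D (u t y) *v pd_x u t y) (at y)" for y
      unfolding D_def
      by (rule has_vector_derivative_compose_jacobian[where g = "\<lambda>s. u s y", OF _ u_t]
          has_vector_derivative_compose_jacobian[OF _ u_x] E_diff u_in \<open>0 < t\<close>)+
    have pd_x_Eu: "pd_x (\<lambda>t x. E (u t x)) t y = D (u t y) *v pd_x u t y" for y
      unfolding pd_x_def[of "\<lambda>t x. E (u t x)"] by (rule vector_derivative_at[OF Eu_x])
    have T1: "taylor_coeff F (\<lambda>j. U j t y) 1 = A (E (u t y)) *v U 1 t y"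
      "taylor_coeff R (\<lambda>j. U j t y) 1 = B (E (u t y)) *v U 1 t y" for y
      unfolding taylor_coeff_1 U0[OF \<open>0 < t\<close>] A_def B_def
      using F_diff R_diff E_in u_in[OF \<open>0 < t\<close>] by (simp_all add: frechet_derivative_eq_jacobian)
    \<comment> \<open>Needed at every \<open>y\<close>, not only at \<open>x\<close>, since the
      resulting flux identity is differentiated in space.\<close>
    have corrector: "B (E (u t y)) *v U 1 t y = - (A (E (u t y)) *v (D (u t y) *v pd_x u t y))" for y
    proof -
      have "((\<lambda>y. F (E (u t y))) has_vector_derivative
          A (E (u t y)) *v (D (u t y) *v pd_x u t y)) (at y)"
        unfolding A_def
        using has_vector_derivative_compose_jacobian[OF F_diff[OF E_in[OF u_in[OF \<open>0 < t\<close>]]] Eu_x] .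
      then have "pd_x (\<lambda>t x. taylor_coeff F (\<lambda>j. U j t x) 0) t y
          = A (E (u t y)) *v (D (u t y) *v pd_x u t y)"
        by (simp add: pd_x_def taylor_coeff_0 U0[OF \<open>0 < t\<close>] vector_derivative_at)
      \<comment> \<open>At \<open>k = 0\<close> the time term has index -1, where
        \<open>coeff_int\<close> is 0, while the coefficient of \<open>R\<close> has index
        1.\<close>
      then show ?thesis
        using coeffs[OF \<open>0 < t\<close>, of 0 y] T1(2)
        by (simp add: coeff_int_def pd_t_def)
    qed
    let ?G = "\<lambda>y. A (E (u t y)) *v U 1 t y"
    \<comment> \<open>\<open>vector_derivative\<close> is total, so an equation for its value says
      something about the actual derivative only once differentiability is known.\<close>
    have G_diff: "?G differentiable at x"
      unfolding A_def
      by (rule jacobian_mult_differentiable[where z = "\<lambda>y. E (u t y)"])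
        (fact \<open>smooth_on \<Omega> F\<close> E_in[OF u_in[OF \<open>0 < t\<close>]] differentiableI_vector[OF Eu_x] U1_diff)+
    have flux: "((\<lambda>y. Q *v ?G y) has_vector_derivative - pd_t u t x) (at x)"
    proof -
      \<comment> \<open>The identification of \<open>U 0\<close> with \<open>E(u)\<close> is
        available only for positive times, so the derivative is transferred within the open
        half-line.\<close>
      have "((\<lambda>s. U 0 s x) has_vector_derivative D (u t x) *v pd_t u t x) (at t)"
        by (rule has_vector_derivative_transform_within_open[OF Eu_t, of "{0<..}"])
          (use \<open>0 < t\<close> U0 in auto)
      then have "pd_t (\<lambda>t x. U 0 t x) t x = D (u t x) *v pd_t u t x"
        by (simp add: pd_t_def vector_derivative_at)
      moreover have "pd_x (\<lambda>t x. taylor_coeff F (\<lambda>j. U j t x) 1) t x = vector_derivative ?G (at x)"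
        unfolding pd_x_def T1 ..
      \<comment> \<open>At \<open>k = 1\<close> the index shifts leave the time derivative of
        \<open>U 0\<close> and the second coefficient of \<open>R\<close>. Applying \<open>Q\<close>
        then removes the latter and turns the former into \<open>pd_t u t x\<close>.\<close>
      ultimately have "D (u t x) *v pd_t u t x + vector_derivative ?G (at x)
          = - taylor_coeff R (\<lambda>j. U j t x) 2"
        using coeffs[OF \<open>0 < t\<close>, of 1 x] by (simp add: coeff_int_def)
      then have "Q *v (D (u t x) *v pd_t u t x + vector_derivative ?G (at x))
          = Q *v (- taylor_coeff R (\<lambda>j. U j t x) 2)"
        by simp
      moreover have "Q *v taylor_coeff R (\<lambda>j. U j t x) 2 = 0"
        using \<open>open \<Omega>\<close> \<open>smooth_on \<Omega> R\<close> \<open>\<And>U. U \<in> \<Omega> \<Longrightarrow> Q *v R U = 0\<close>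
        by (rule taylor_coeff_matrix_vector_eq_0) (use E_in u_in U0 \<open>0 < t\<close> in auto)
      ultimately have "Q *v vector_derivative ?G (at x) = - pd_t u t x"
        by (simp add: matrix_vector_right_distrib linear_neg[OF matrix_vector_mul_linear]
            QD[OF u_in[OF \<open>0 < t\<close>]] add_eq_0_iff)
      then show ?thesis
        using bounded_linear.has_vector_derivative[OF matrix_vector_mul_bounded_linear
            G_diff[unfolded vector_derivative_works], of Q]
        by simp
    qed
    moreover have "((\<lambda>y. M (u t y) *v pd_x u t y) has_vector_derivative pd_t u t x) (at x)"
    proof -
      \<comment> \<open>The two fluxes agree up to sign as functions of \<open>y\<close>, so the
        diffusive form inherits its derivative from \<open>flux\<close>.\<close>
      have "M (u t y) *v pd_x u t y = - (Q *v ?G y)" for y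
        by (rule M_corrector[OF u_in[OF \<open>0 < t\<close>] corrector QU[OF \<open>0 < t\<close>]])
      then show ?thesis using has_vector_derivative_minus[OF flux] by (simp only: minus_minus)
    qed
    moreover have "B (E (u t x)) *v V = - (A (E (u t x)) *v pd_x (\<lambda>t x. E (u t x)) t x) \<and> Q *v V = 0
        \<longleftrightarrow> V = U 1 t x" for V
    proof
      assume "B (E (u t x)) *v V = - (A (E (u t x)) *v pd_x (\<lambda>t x. E (u t x)) t x) \<and> Q *v V = 0"
      \<comment> \<open>The difference of two solutions lies in the kernels of both
        \<open>B (E (u t x))\<close> and \<open>Q\<close>.\<close>
      then have "V - U 1 t x = 0"
        using corrector[of x] QU[OF \<open>0 < t\<close>, of x]
        by - (rule ker0[OF u_in[OF \<open>0 < t\<close>, of x]],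
            simp_all add: pd_x_Eu matrix_vector_mult_diff_distrib)
      then show "V = U 1 t x" by simp
    qed (use corrector[of x] QU[OF \<open>0 < t\<close>, of x] in \<open>simp add: pd_x_Eu\<close>)
    ultimately show "((\<lambda>y. Q *v ?G y) has_vector_derivative - pd_t u t x) (at x) \<and>
        ((\<lambda>y. M (u t y) *v pd_x u t y) has_vector_derivative pd_t u t x) (at x) \<and>
        (\<forall>V. B (E (u t x)) *v V = - (A (E (u t x)) *v pd_x (\<lambda>t x. E (u t x)) t x) \<and> Q *v V = 0
              \<longleftrightarrow> V = U 1 t x)"
      by blast
  qed
qed

end
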